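(* Let $(Y,\mathbf{X})$ be a random vector with values in $\mathbb{R}\times\mathbb{R}^d$, $d\ge 1$, such that the distribution function $F_Y$ of $Y$ is continuous, and let $(Y,Y')$ be the Markov product of $Y$ given $\mathbf{X}$. Then $$\xi(Y,\mathbf{X}) = 6\int_{\mathbb{R}} \mathbb{P}(Y\ge y,\,Y'\ge y)\,\mathrm{d}\mathbb{P}^{Y}(y) - 2 = 3\int_0^1 \mathbb{P}\bigl(|F_Y(Y)-F_Y(Y')|\le s\bigr)\,\mathrm{d}s - 2 .$$
   Context: $\mathbb{P}^Y$ denotes the law of $Y$. Chatterjee's rank correlation is $$\xi(Y,\mathbf{X}) := \frac{\int_{\mathbb{R}} \mathrm{Var}\bigl(\mathbb{P}(Y\ge y\mid \mathbf{X})\bigr)\,\mathrm{d}\mathbb{P}^Y(y)}{\int_{\mathbb{R}} \mathrm{Var}\bigl(\mathbf{1}_{\{Y\ge y\}}\bigr)\,\mathrm{d}\mathbb{P}^Y(y)} .$$ The Markov product $(Y,Y')$ is a pair (defined on a possibly extended probability space) such that, conditionally on $\mathbf{X}$, $Y$ and $Y'$ are independent and identically distributed, i.e. $\mathbb{P}(Y\in A, Y'\in B\mid \mathbf{X})=\mathbb{P}(Y\in A\mid\mathbf{X})\,\mathbb{P}(Y\in B\mid\mathbf{X})$ almost surely for all Borel sets $A,B\subseteq\mathbb{R}$. *)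

theory Defs
  imports "HOL-Probability.Probability"
begin

text \<open>\<open>cond_prob_given M X A\<close> is a version of the conditional probability of the event \<open>A\<close>
  given the random variable \<open>X\<close>, i.e. given the sigma-algebra generated by \<open>X\<close>.\<close>

definition cond_prob_given ::
    "'a measure \<Rightarrow> ('a \<Rightarrow> 'b::topological_space) \<Rightarrow> 'a set \<Rightarrow> 'a \<Rightarrow> real" where
  "cond_prob_given M X A =
     real_cond_exp M (vimage_algebra (space M) X borel) (indicator A)"

definition chatterjee_xi ::
    "'a measure \<Rightarrow> ('a \<Rightarrow> real) \<Rightarrow> ('a \<Rightarrow> 'b::topological_space) \<Rightarrow> real" where
  "chatterjee_xi M Y X =
     (LINT y|distr M borel Y.
        prob_space.variance M (cond_prob_given M X {\<omega> \<in> space M. Y \<omega> \<ge> y})) /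
     (LINT y|distr M borel Y.
        prob_space.variance M (indicator {\<omega> \<in> space M. Y \<omega> \<ge> y}))"

text \<open>\<open>N\<close> extends the probability space \<open>M\<close> via the measure-preserving projection \<open>\<pi>\<close>; a random
  variable \<open>Z\<close> on \<open>M\<close> is identified with \<open>Z \<circ> \<pi>\<close> on \<open>N\<close>.\<close>

definition prob_space_extension ::
    "'a measure \<Rightarrow> 'c measure \<Rightarrow> ('c \<Rightarrow> 'a) \<Rightarrow> bool" where
  "prob_space_extension M N \<pi> \<longleftrightarrow>
     prob_space N \<and> \<pi> \<in> measurable N M \<and> distr N M \<pi> = M"

text \<open>Both factors on the right-hand side are conditional probabilities of \<open>Y\<close>. Taking
  \<open>A = UNIV\<close> shows that \<open>Y'\<close> has the same conditional law as \<open>Y\<close>, so that the identity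
  expresses conditional independence and conditional equality in law together.\<close>

definition markov_product ::
    "'a measure \<Rightarrow> ('a \<Rightarrow> real) \<Rightarrow> ('a \<Rightarrow> real) \<Rightarrow> ('a \<Rightarrow> 'b::topological_space) \<Rightarrow> bool" where
  "markov_product M Y Y' X \<longleftrightarrow>
     Y \<in> borel_measurable M \<and> Y' \<in> borel_measurable M \<and> X \<in> borel_measurable M \<and>
     (\<forall>A\<in>sets borel. \<forall>B\<in>sets borel. AE \<omega> in M.
        cond_prob_given M X {\<omega> \<in> space M. Y \<omega> \<in> A \<and> Y' \<omega> \<in> B} \<omega> =
        cond_prob_given M X {\<omega> \<in> space M. Y \<omega> \<in> A} \<omega> *
        cond_prob_given M X {\<omega> \<in> space M. Y \<omega> \<in> B} \<omega>)"

end

theory Submission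
  imports Defs
begin

text \<open>
  Write \<open>\<mu>\<close> for the law of \<open>Y\<close>, \<open>F\<close> for its distribution function, \<open>Y\<close> also for its lift to the
  extended space, and \<open>H y\<close> for the probability of \<open>Y \<ge> y \<and> Y' \<ge> y\<close>. Everything rests on three
  observations.

  Since \<open>F\<close> is continuous, \<open>F\<close> is uniformly distributed on \<open>[0,1]\<close> under \<open>\<mu>\<close>
  (\<open>cdf_uniformly_distributed\<close>) and \<open>Y\<close> has no atoms, so \<open>Y \<ge> y\<close> has probability \<open>1 - F y\<close>. The
  denominator of the rank correlation is therefore \<open>\<integral>F - F\<^sup>2 d\<mu> = 1/2 - 1/3 = 1/6\<close>, for
  every continuous \<open>F\<close>.

  The conditional probability of \<open>Y \<ge> y\<close> given \<open>X\<close> has mean \<open>1 - F y\<close>, and its second moment is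
  \<open>H y\<close>: squaring a conditional probability of \<open>Y\<close> means multiplying it with that of the
  conditionally independent copy \<open>Y'\<close> (\<open>variance_cond_prob_given_eq\<close>). The numerator is thus
  \<open>\<integral>H d\<mu> - \<integral>(1 - F)\<^sup>2 d\<mu> = \<integral>H d\<mu> - 1/3\<close>, which gives the first identity. Conditional
  probabilities enter the rank correlation on the original space but the Markov product on the
  extended one; \<open>cond_prob_given_extension\<close> identifies the two.

  For the second identity, Fubini's theorem turns \<open>\<integral>H d\<mu>\<close> into the expectation of
  \<open>F (min Y Y') = (F Y + F Y' - D) / 2\<close> with \<open>D = \<bar>F Y - F Y'\<bar>\<close>. As \<open>Y'\<close> has the same law as
  \<open>Y\<close>, this is \<open>(1 - E D) / 2\<close>. Fubini's theorem also shows that the distribution function of \<open>D\<close>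
  integrates to \<open>1 - E D\<close> over \<open>[0,1]\<close>, and both sides equal \<open>1 - 3 E D\<close>.
\<close>

section \<open>Continuous distribution functions\<close>

lemma (in real_distribution) borel_measurable_cdf: "cdf M \<in> borel_measurable borel"
  using borel_measurable_mono[of "cdf M"] cdf_nondecreasing by (simp add: mono_def)

lemma (in real_distribution) cdf_attains_interior:
  assumes cont: "continuous_on UNIV (cdf M)" and u: "0 < u" "u < 1"
  shows "\<exists>x. cdf M x = u"
proof -
  have "eventually (\<lambda>x. cdf M x < u) at_bot"
    using cdf_lim_at_bot u(1) by (rule order_tendstoD)
  then obtain a where a: "cdf M a < u"
    using eventually_happens'[OF trivial_limit_at_bot_linorder] by blast
  have "eventually (\<lambda>x. u < cdf M x) at_top"
    using cdf_lim_at_top_prob u(2) by (rule order_tendstoD)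
  then obtain b where b: "u < cdf M b"
    using eventually_happens'[OF trivial_limit_at_top_linorder] by blast
  have "a \<le> b"
    using a b cdf_nondecreasing[of b a] by linarith
  then show ?thesis
    using IVT'[of "cdf M" a u b] a b continuous_on_subset[OF cont subset_UNIV] by auto
qed

text \<open>
  If \<open>cdf M z = u\<close>, then monotonicity places \<open>{..z}\<close>, which has probability \<open>u\<close>, inside the event
  \<open>cdf M x \<le> u\<close>, and places \<open>cdf M x \<le> t\<close> inside \<open>{..z}\<close> whenever \<open>t < u\<close>. The first inclusion
  with \<open>u = t\<close> bounds the probability from below, the second with \<open>u\<close> decreasing to \<open>t\<close> from above.
  Comparing with levels \<open>u > t\<close> handles intervals on which \<open>cdf M\<close> is constant.
\<close>

lemma (in real_distribution) prob_cdf_le: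
  assumes cont: "continuous_on UNIV (cdf M)" and t: "0 \<le> t" "t \<le> 1"
  shows "\<P>(x in M. cdf M x \<le> t) = t"
proof -
  have [measurable]: "cdf M \<in> borel_measurable M"
    by (rule measurable_finite_borel[OF borel_measurable_cdf])
  have upper: "\<P>(x in M. cdf M x \<le> t) \<le> t" if "t < 1"
  proof (rule dense_ge_bounded[OF that])
    fix u assume u: "t < u" "u < 1"
    then obtain z where z: "cdf M z = u"
      using cdf_attains_interior[OF cont, of u] t by auto
    have "x \<le> z" if "cdf M x \<le> t" for x
      using cdf_nondecreasing[of z x] that u z by linarith
    then have "\<P>(x in M. cdf M x \<le> t) \<le> prob {..z}"
      by (intro finite_measure_mono) auto
    then show "\<P>(x in M. cdf M x \<le> t) \<le> u"
      using z by (simp add: cdf_def2)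
  qed
  have lower: "t \<le> \<P>(x in M. cdf M x \<le> t)" if t': "0 < t" "t < 1"
  proof -
    obtain z where z: "cdf M z = t"
      using cdf_attains_interior[OF cont t'] by auto
    have "prob {..z} \<le> \<P>(x in M. cdf M x \<le> t)"
      using cdf_nondecreasing[of _ z] z by (intro finite_measure_mono) auto
    then show ?thesis
      using z by (simp add: cdf_def2)
  qed
  consider "t = 0" | "0 < t" "t < 1" | "t = 1"
    using t by linarith
  then show ?thesis
  proof cases
    case 1
    then show ?thesis using upper measure_nonneg[of M "{x \<in> space M. cdf M x \<le> t}"] by linarith
  next
    case 2
    then show ?thesis using upper lower by linarith
  next
    case 3
    then show ?thesis using cdf_bounded_prob prob_space by simp
  qed
qed

text \<open>The probability integral transform.\<close>

lemma (in real_distribution) cdf_uniformly_distributed: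
  assumes "continuous_on UNIV (cdf M)"
  shows "distributed M lborel (cdf M) (\<lambda>x. indicator {0..1} x / measure lborel {0..1::real})"
proof (rule uniform_distrI_borel_atLeastAtMost)
  show "cdf M \<in> borel_measurable M"
    by (rule measurable_finite_borel[OF borel_measurable_cdf])
qed (use prob_cdf_le[OF assms] in auto)

lemma (in real_distribution) integrable_cdf_power [simp]: "integrable M (\<lambda>x. cdf M x ^ k)"
proof (rule integrable_const_bound[where B = 1])
  show "AE x in M. norm (cdf M x ^ k) \<le> 1"
    using cdf_nonneg cdf_bounded_prob by (auto simp: power_le_one)
  note [measurable] = measurable_finite_borel[OF borel_measurable_cdf]
  show "(\<lambda>x. cdf M x ^ k) \<in> borel_measurable M"
    by measurable
qed

text \<open>The uniform law on \<open>[0,1]\<close> has mean \<open>1/2\<close> and variance \<open>1/12\<close>.\<close>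

lemma (in real_distribution) cdf_moments:
  assumes "continuous_on UNIV (cdf M)"
  shows "expectation (cdf M) = 1 / 2" and "expectation (\<lambda>x. (cdf M x)\<^sup>2) = 1 / 3"
proof -
  note U = cdf_uniformly_distributed[OF assms]
  show mean: "expectation (cdf M) = 1 / 2"
    using uniform_distributed_expectation[OF U] by simp
  have "expectation (\<lambda>x. (cdf M x)\<^sup>2) - (expectation (cdf M))\<^sup>2 = 1 / 12"
    using variance_eq[of "cdf M"] integrable_cdf_power[of 1] integrable_cdf_power[of 2]
      uniform_distributed_variance[OF U] by simp
  then show "expectation (\<lambda>x. (cdf M x)\<^sup>2) = 1 / 3"
    unfolding mean by (simp add: power2_eq_square)
qed

lemma (in real_distribution) prob_atLeast_eq:
  assumes "continuous_on UNIV (cdf M)"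
  shows "prob {y..} = 1 - cdf M y"
proof -
  have "isCont (cdf M) y"
    using assms by (simp add: continuous_on_eq_continuous_at)
  then have "prob {y} = 0"
    by (simp add: isCont_cdf)
  moreover have "prob {..y} = prob {..<y} + prob {y}"
    by (subst finite_measure_Union[symmetric]) (auto intro!: arg_cong[where f = prob])
  moreover have "prob {y..} = 1 - prob {..<y}"
    by (subst prob_compl[symmetric]) (auto intro!: arg_cong[where f = prob])
  ultimately show ?thesis
    by (simp add: cdf_def2)
qed

section \<open>Integrals of probabilities by Fubini\<close>

text \<open>
  Both integrals are the product measure of the set \<open>{(x, y). P x y}\<close>; this is Fubini's theorem for
  its indicator function.
\<close>

lemma integral_measure_section_swap:
  assumes "finite_measure M" and "finite_measure N"
    and [measurable]: "Measurable.pred (M \<Otimes>\<^sub>M N) (\<lambda>(x, y). P x y)"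
  shows "(LINT x|M. measure N {y \<in> space N. P x y}) = (LINT y|N. measure M {x \<in> space M. P x y})"
proof -
  interpret M: finite_measure M by fact
  interpret N: finite_measure N by fact
  interpret pair_sigma_finite M N ..
  interpret MN: finite_measure "M \<Otimes>\<^sub>M N"
    using finite_measure_pair_measure[OF assms(2,1)] .
  let ?f = "\<lambda>x y. of_bool (P x y) :: real"
  have "integrable (M \<Otimes>\<^sub>M N) (case_prod ?f)"
    by (rule MN.integrable_const_bound[where B = 1]) (auto simp: split_beta)
  then have "(LINT y|N. (LINT x|M. ?f x y)) = (LINT x|M. (LINT y|N. ?f x y))"
    by (rule Fubini_integral)
  moreover have "(LINT y|N. ?f x y) = measure N {y \<in> space N. P x y}" if "x \<in> space M" for x
  proof -
    have "{y \<in> space N. P x y} \<in> sets N"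
      using that by measurable
    moreover have "(LINT y|N. ?f x y) = (LINT y|N. indicator {y \<in> space N. P x y} y)"
      by (intro Bochner_Integration.integral_cong) (auto simp: indicator_def)
    ultimately show ?thesis by simp
  qed
  moreover have "(LINT x|M. ?f x y) = measure M {x \<in> space M. P x y}" if "y \<in> space N" for y
  proof -
    have "{x \<in> space M. P x y} \<in> sets M"
      using that by measurable
    moreover have "(LINT x|M. ?f x y) = (LINT x|M. indicator {x \<in> space M. P x y} x)"
      by (intro Bochner_Integration.integral_cong) (auto simp: indicator_def)
    ultimately show ?thesis by simp
  qed
  ultimately show ?thesis
    by (simp cong: Bochner_Integration.integral_cong)
qed

lemma (in real_distribution) integral_prob_ge:
  assumes "prob_space N" and [measurable]: "Z \<in> borel_measurable N"
  shows "(LINT y|M. \<P>(\<omega> in N. y \<le> Z \<omega>)) = (LINT \<omega>|N. cdf M (Z \<omega>))"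
proof -
  interpret N: prob_space N by fact
  have "(LINT y|M. \<P>(\<omega> in N. y \<le> Z \<omega>)) = (LINT \<omega>|N. \<P>(y in M. y \<le> Z \<omega>))"
    by (rule integral_measure_section_swap[OF finite_measure_axioms N.finite_measure_axioms]) measurable
  then show ?thesis by (simp add: cdf_def atMost_def)
qed

text \<open>
  For fixed \<open>\<omega>\<close> the levels \<open>s \<in> [0,1]\<close> with \<open>D \<omega> \<le> s\<close> form the interval \<open>[D \<omega>, 1]\<close>, of length
  \<open>1 - D \<omega>\<close>.
\<close>

lemma (in prob_space) integral_distribution_function:
  assumes [measurable]: "D \<in> borel_measurable M" and D: "\<And>\<omega>. \<omega> \<in> space M \<Longrightarrow> 0 \<le> D \<omega> \<and> D \<omega> \<le> 1"
  shows "(LBINT s:{0..1}. \<P>(\<omega> in M. D \<omega> \<le> s)) = 1 - expectation D"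
proof -
  \<comment> \<open>Restricting Lebesgue measure to the unit interval makes it finite, as the exchange requires.\<close>
  let ?L = "restrict_space lborel {0..1::real}"
  have fin: "finite_measure ?L"
    by (rule finite_measureI) (simp add: emeasure_restrict_space space_restrict_space)
  have [measurable]: "(\<lambda>x. x) \<in> borel_measurable ?L"
    by (rule measurable_restrict_space1) simp
  have "(LBINT s:{0..1}. \<P>(\<omega> in M. D \<omega> \<le> s)) = (LINT s|?L. \<P>(\<omega> in M. D \<omega> \<le> s))"
    by (simp add: set_lebesgue_integral_def integral_restrict_space)
  also have "\<dots> = (LINT \<omega>|M. measure ?L {s \<in> space ?L. D \<omega> \<le> s})"
    by (rule integral_measure_section_swap[OF fin finite_measure_axioms]) measurable
  also have "\<dots> = (LINT \<omega>|M. 1 - D \<omega>)"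
  proof (rule Bochner_Integration.integral_cong)
    fix \<omega> assume "\<omega> \<in> space M"
    then have "0 \<le> D \<omega>" "D \<omega> \<le> 1" using D by auto
    moreover from this have "{s \<in> space ?L. D \<omega> \<le> s} = {D \<omega>..1}"
      by (auto simp: space_restrict_space)
    ultimately show "measure ?L {s \<in> space ?L. D \<omega> \<le> s} = 1 - D \<omega>"
      by (simp add: measure_restrict_space)
  qed simp
  also have "\<dots> = 1 - expectation D"
  proof -
    have "integrable M D"
      by (rule integrable_const_bound[where B = 1]) (use D in auto)
    then show ?thesis by (simp add: prob_space)
  qed
  finally show ?thesis .
qed

section \<open>Conditional probabilities and the Markov product\<close>

lemma (in prob_space) subalgebra_generated:
  assumes "X \<in> borel_measurable M"
  shows "finite_measure_subalgebra M (vimage_algebra (space M) X borel)"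
proof (unfold_locales)
  show "subalgebra M (vimage_algebra (space M) X borel)"
    unfolding subalgebra_def using sets_image_in_sets[OF refl assms] by simp
qed

lemma (in prob_space) cond_prob_given_expectation:
  assumes "X \<in> borel_measurable M" and "A \<in> events"
  shows "integrable M (cond_prob_given M X A)" "expectation (cond_prob_given M X A) = prob A"
proof -
  interpret finite_measure_subalgebra M "vimage_algebra (space M) X borel"
    by (rule subalgebra_generated) fact
  have "integrable M (indicator A :: _ \<Rightarrow> real)"
    using assms(2) by (simp add: emeasure_eq_measure)
  from real_cond_exp_int[OF this] show "integrable M (cond_prob_given M X A)"
    "expectation (cond_prob_given M X A) = prob A"
    using assms by (simp_all add: cond_prob_given_def)
qed

text \<open>
  Conditioning commutes with passing to an extension. Every event generated by \<open>X \<circ> \<pi>\<close> is the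
  preimage under \<open>\<pi>\<close> of an event generated by \<open>X\<close>, and \<open>\<pi>\<close> preserves integrals. So the lifted
  conditional probability has the averages over such events that characterize the conditional
  probability on the extension.
\<close>

lemma cond_prob_given_extension:
  assumes "prob_space M" and ext: "prob_space_extension M N \<pi>"
    and X [measurable]: "X \<in> borel_measurable M" and A [measurable]: "A \<in> sets M"
  shows "AE \<omega> in N. cond_prob_given N (X \<circ> \<pi>) {\<omega> \<in> space N. \<pi> \<omega> \<in> A} \<omega> = cond_prob_given M X A (\<pi> \<omega>)"
proof -
  interpret M: prob_space M by fact
  interpret N: prob_space N using ext by (simp add: prob_space_extension_def)
  have \<pi> [measurable]: "\<pi> \<in> measurable N M" and M_eq: "distr N M \<pi> = M"
    using ext by (simp_all add: prob_space_extension_def)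
  have transfer: "(LINT \<omega>|N. f (\<pi> \<omega>)) = (LINT \<omega>|M. f \<omega>)" if "f \<in> borel_measurable M"
    for f :: "'a \<Rightarrow> real"
    using integral_distr[OF \<pi> that] by (simp add: M_eq)
  let ?FM = "vimage_algebra (space M) X borel" and ?FN = "vimage_algebra (space N) (X \<circ> \<pi>) borel"
  let ?A = "{\<omega> \<in> space N. \<pi> \<omega> \<in> A}"
  have XN [measurable]: "X \<circ> \<pi> \<in> borel_measurable N" by measurable
  interpret M: finite_measure_subalgebra M ?FM by (rule M.subalgebra_generated) fact
  interpret N: finite_measure_subalgebra N ?FN by (rule N.subalgebra_generated) fact
  let ?p = "cond_prob_given M X A"
  have p_F: "?p \<in> borel_measurable ?FM"
    by (simp add: cond_prob_given_def)
  have p_int: "integrable M ?p"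
    by (rule M.cond_prob_given_expectation) fact+
  have [measurable]: "?p \<in> borel_measurable M"
    using p_int by simp
  show ?thesis unfolding cond_prob_given_def[of N]
  proof (rule N.real_cond_exp_charact)
    fix B assume "B \<in> sets ?FN"
    then obtain C where C [measurable]: "C \<in> sets borel" and B: "B = (X \<circ> \<pi>) -` C \<inter> space N"
      by (auto simp: sets_vimage_algebra2)
    define B' where "B' = X -` C \<inter> space M"
    have B'_F: "B' \<in> sets ?FM" and [measurable]: "B' \<in> sets M"
      unfolding B'_def by (auto intro: in_vimage_algebra)
    have ind: "indicator B \<omega> = (indicator B' (\<pi> \<omega>) :: real)" if "\<omega> \<in> space N" for \<omega>
      using that measurable_space[OF \<pi> that] by (auto simp: B B'_def indicator_def)
    have indA: "indicator ?A \<omega> = (indicator A (\<pi> \<omega>) :: real)" if "\<omega> \<in> space N" for \<omega>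
      using that by (auto simp: indicator_def)
    have "(LINT \<omega>:B|N. indicator ?A \<omega>) = (LINT \<omega>|N. indicator B' (\<pi> \<omega>) * (indicator A (\<pi> \<omega>) :: real))"
      unfolding set_lebesgue_integral_def
      by (intro Bochner_Integration.integral_cong) (simp_all add: ind indA)
    also have "\<dots> = (LINT \<omega>:B'|M. indicator A \<omega>)"
      unfolding set_lebesgue_integral_def
      using transfer[of "\<lambda>\<omega>. indicator B' \<omega> * indicator A \<omega>"] by simp
    also have "\<dots> = (LINT \<omega>:B'|M. ?p \<omega>)"
      unfolding cond_prob_given_def by (rule M.real_cond_exp_intA) (simp_all add: B'_F M.emeasure_eq_measure)
    also have "\<dots> = (LINT \<omega>|N. indicator B' (\<pi> \<omega>) * ?p (\<pi> \<omega>))"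
      unfolding set_lebesgue_integral_def
      using transfer[of "\<lambda>\<omega>. indicator B' \<omega> * ?p \<omega>"] by simp
    also have "\<dots> = (LINT \<omega>:B|N. ?p (\<pi> \<omega>))"
      unfolding set_lebesgue_integral_def
      by (intro Bochner_Integration.integral_cong) (auto simp: ind)
    finally show "(LINT \<omega>:B|N. indicator ?A \<omega>) = (LINT \<omega>:B|N. ?p (\<pi> \<omega>))" .
  next
    show "integrable N (\<lambda>\<omega>. ?p (\<pi> \<omega>))"
      using integrable_distr[OF \<pi>, of ?p] p_int by (simp add: M_eq)
    have "X \<circ> \<pi> \<in> borel_measurable ?FN"
      by (rule measurable_vimage_algebra1) simp
    then have "\<pi> \<in> measurable ?FN ?FM"
      using measurable_space[OF \<pi>] by (intro measurable_vimage_algebra2) (auto simp: comp_def)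
    then show "(\<lambda>\<omega>. ?p (\<pi> \<omega>)) \<in> borel_measurable ?FN"
      using p_F by (rule measurable_compose)
  qed (simp add: N.emeasure_eq_measure)
qed

text \<open>
  The integrated form of the defining property of the Markov product. Integrability of the product
  comes with it, because the product is almost everywhere a conditional probability.
\<close>

lemma (in prob_space) markov_product_joint_prob:
  assumes mp: "markov_product M Y Y' X" and AB: "A \<in> sets borel" "B \<in> sets borel"
  defines "p \<equiv> \<lambda>C. cond_prob_given M X {\<omega> \<in> space M. Y \<omega> \<in> C}"
  shows "integrable M (\<lambda>\<omega>. p A \<omega> * p B \<omega>)"
    and "\<P>(\<omega> in M. Y \<omega> \<in> A \<and> Y' \<omega> \<in> B) = expectation (\<lambda>\<omega>. p A \<omega> * p B \<omega>)"
proof -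
  have [measurable]: "Y \<in> borel_measurable M" "Y' \<in> borel_measurable M" "X \<in> borel_measurable M"
    using mp by (simp_all add: markov_product_def)
  note [measurable] = AB
  let ?q = "cond_prob_given M X {\<omega> \<in> space M. Y \<omega> \<in> A \<and> Y' \<omega> \<in> B}"
  have factor: "AE \<omega> in M. ?q \<omega> = p A \<omega> * p B \<omega>"
    using mp AB by (simp add: markov_product_def p_def)
  have q: "integrable M ?q" "expectation ?q = \<P>(\<omega> in M. Y \<omega> \<in> A \<and> Y' \<omega> \<in> B)"
    by (rule cond_prob_given_expectation; measurable)+
  have "p C \<in> borel_measurable M" if [measurable]: "C \<in> sets borel" for C
    unfolding p_def by (rule borel_measurable_integrable, rule cond_prob_given_expectation) measurable
  then have p_meas: "(\<lambda>\<omega>. p A \<omega> * p B \<omega>) \<in> borel_measurable M"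
    using AB by simp
  show "integrable M (\<lambda>\<omega>. p A \<omega> * p B \<omega>)"
    using integrable_cong_AE[OF _ p_meas factor] q(1) by simp
  show "\<P>(\<omega> in M. Y \<omega> \<in> A \<and> Y' \<omega> \<in> B) = expectation (\<lambda>\<omega>. p A \<omega> * p B \<omega>)"
    using integral_cong_AE[OF _ p_meas factor] q by simp
qed

text \<open>
  Taking the whole line as the first Borel set removes the condition on \<open>Y\<close>: its conditional
  probability is \<open>1\<close>, and what remains on the right is the conditional probability of \<open>Y \<in> B\<close>.
\<close>

lemma (in prob_space) markov_product_same_law:
  assumes mp: "markov_product M Y Y' X"
  shows "distr M borel Y' = distr M borel Y"
proof (rule measure_eqI)
  have [measurable]: "Y \<in> borel_measurable M" "Y' \<in> borel_measurable M" "X \<in> borel_measurable M"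
    using mp by (simp_all add: markov_product_def)
  fix B assume "B \<in> sets (distr M borel Y')"
  then have [measurable]: "B \<in> sets borel" by simp
  interpret finite_measure_subalgebra M "vimage_algebra (space M) X borel"
    by (rule subalgebra_generated) simp
  let ?p = "\<lambda>C. cond_prob_given M X {\<omega> \<in> space M. Y \<omega> \<in> C}"
  have "AE \<omega> in M. cond_prob_given M X (space M) \<omega> = 1"
    unfolding cond_prob_given_def
  proof (rule real_cond_exp_charact)
    show "(LINT \<omega>:C|M. indicator (space M) \<omega>) = (LINT \<omega>:C|M. 1)" for C
      unfolding set_lebesgue_integral_def
      by (intro Bochner_Integration.integral_cong) auto
  qed (simp_all add: emeasure_eq_measure)
  then have eq: "AE \<omega> in M. ?p UNIV \<omega> * ?p B \<omega> = ?p B \<omega>"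
    by eventually_elim simp
  have pB: "integrable M (?p B)" "expectation (?p B) = \<P>(\<omega> in M. Y \<omega> \<in> B)"
    by (rule cond_prob_given_expectation; measurable)+
  have p_int: "integrable M (\<lambda>\<omega>. ?p UNIV \<omega> * ?p B \<omega>)"
    by (rule markov_product_joint_prob(1)[OF mp]) auto
  have "\<P>(\<omega> in M. Y' \<omega> \<in> B) = expectation (\<lambda>\<omega>. ?p UNIV \<omega> * ?p B \<omega>)"
    using markov_product_joint_prob(2)[OF mp, of UNIV B] by simp
  also have "\<dots> = expectation (?p B)"
    by (rule integral_cong_AE[OF _ _ eq]) (use p_int pB in \<open>simp_all only: borel_measurable_integrable\<close>)
  finally have "\<P>(\<omega> in M. Y' \<omega> \<in> B) = \<P>(\<omega> in M. Y \<omega> \<in> B)"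
    by (simp only: pB)
  moreover have "Z -` B \<inter> space M = {\<omega> \<in> space M. Z \<omega> \<in> B}" for Z
    by auto
  ultimately show "emeasure (distr M borel Y') B = emeasure (distr M borel Y) B"
    by (simp add: emeasure_distr emeasure_eq_measure)
qed simp

text \<open>
  The variance is the second moment minus the squared mean. By the tower property the mean is the
  probability of \<open>Y \<in> A\<close>. The second moment is computed on the extension, where the square
  of the conditional probability is that of the joint event \<open>Y \<in> A \<and> Y' \<in> A\<close>.
\<close>

lemma variance_cond_prob_given_eq:
  assumes "prob_space M" and Y [measurable]: "Y \<in> borel_measurable M"
    and X [measurable]: "X \<in> borel_measurable M"
    and ext: "prob_space_extension M N \<pi>" and mp: "markov_product N (Y \<circ> \<pi>) Y' (X \<circ> \<pi>)"
    and A [measurable]: "A \<in> sets borel"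
  shows "prob_space.variance M (cond_prob_given M X {\<omega> \<in> space M. Y \<omega> \<in> A}) =
    \<P>(\<omega> in N. Y (\<pi> \<omega>) \<in> A \<and> Y' \<omega> \<in> A) - (\<P>(\<omega> in M. Y \<omega> \<in> A))\<^sup>2"
proof -
  interpret M: prob_space M by fact
  interpret N: prob_space N using ext by (simp add: prob_space_extension_def)
  have \<pi> [measurable]: "\<pi> \<in> measurable N M" and M_eq: "distr N M \<pi> = M"
    using ext by (simp_all add: prob_space_extension_def)
  let ?p = "cond_prob_given M X {\<omega> \<in> space M. Y \<omega> \<in> A}"
  let ?q = "cond_prob_given N (X \<circ> \<pi>) {\<omega> \<in> space N. (Y \<circ> \<pi>) \<omega> \<in> A}"
  have p: "integrable M ?p" "M.expectation ?p = \<P>(\<omega> in M. Y \<omega> \<in> A)"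
    by (rule M.cond_prob_given_expectation; measurable)+
  then have [measurable]: "?p \<in> borel_measurable M" by simp
  have "{\<omega> \<in> space N. \<pi> \<omega> \<in> {\<omega> \<in> space M. Y \<omega> \<in> A}} = {\<omega> \<in> space N. (Y \<circ> \<pi>) \<omega> \<in> A}"
    using measurable_space[OF \<pi>] by auto
  then have "AE \<omega> in N. ?q \<omega> = ?p (\<pi> \<omega>)"
    using cond_prob_given_extension[OF assms(1) ext X, of "{\<omega> \<in> space M. Y \<omega> \<in> A}"] by simp
  then have eq: "AE \<omega> in N. ?q \<omega> * ?q \<omega> = (?p (\<pi> \<omega>))\<^sup>2"
    by eventually_elim (simp add: power2_eq_square)
  note joint = N.markov_product_joint_prob[OF mp A A]
  have "integrable N (\<lambda>\<omega>. (?p (\<pi> \<omega>))\<^sup>2)"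
    using integrable_cong_AE[OF _ _ eq] joint(1) by simp
  then have "integrable M (\<lambda>\<omega>. (?p \<omega>)\<^sup>2)"
    using integrable_distr_eq[OF \<pi>, of "\<lambda>\<omega>. (?p \<omega>)\<^sup>2"] by (simp add: M_eq)
  moreover have "M.expectation (\<lambda>\<omega>. (?p \<omega>)\<^sup>2) = \<P>(\<omega> in N. Y (\<pi> \<omega>) \<in> A \<and> Y' \<omega> \<in> A)"
    using integral_distr[OF \<pi>, of "\<lambda>\<omega>. (?p \<omega>)\<^sup>2"] integral_cong_AE[OF _ _ eq] joint
    by (simp add: M_eq)
  ultimately show ?thesis
    using M.variance_eq[OF p(1)] p(2) by simp
qed

section \<open>The rank correlation in terms of the Markov product\<close>

theorem theorem1p1:
  fixes M :: "'a measure" and N :: "'c measure" and \<pi> :: "'c \<Rightarrow> 'a"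
    and Y :: "'a \<Rightarrow> real" and X :: "'a \<Rightarrow> real ^ 'd" and Y' :: "'c \<Rightarrow> real"
  assumes "prob_space M"
    and "Y \<in> borel_measurable M"
    and "X \<in> borel_measurable M"
    and "continuous_on UNIV (cdf (distr M borel Y))"
    and "prob_space_extension M N \<pi>"
    and "markov_product N (Y \<circ> \<pi>) Y' (X \<circ> \<pi>)"
  shows "chatterjee_xi M Y X =
           6 * (LINT y|distr M borel Y. \<P>(\<omega> in N. Y (\<pi> \<omega>) \<ge> y \<and> Y' \<omega> \<ge> y)) - 2
       \<and> 6 * (LINT y|distr M borel Y. \<P>(\<omega> in N. Y (\<pi> \<omega>) \<ge> y \<and> Y' \<omega> \<ge> y)) - 2 =
           3 * (LBINT s:{0..1}. \<P>(\<omega> in N.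
             \<bar>cdf (distr M borel Y) (Y (\<pi> \<omega>)) - cdf (distr M borel Y) (Y' \<omega>)\<bar> \<le> s)) - 2"
proof -
  note Y [measurable] = assms(2) and cont = assms(4)
  interpret M: prob_space M by fact
  interpret N: prob_space N using assms(5) by (simp add: prob_space_extension_def)
  have \<pi> [measurable]: "\<pi> \<in> measurable N M" and M_eq: "distr N M \<pi> = M"
    using assms(5) by (simp_all add: prob_space_extension_def)
  have Y' [measurable]: "Y' \<in> borel_measurable N"
    using assms(6) by (simp add: markov_product_def)
  define \<mu> where "\<mu> = distr M borel Y"
  interpret \<mu>: real_distribution \<mu> unfolding \<mu>_def by simp
  let ?F = "cdf \<mu>"
  have cont: "continuous_on UNIV ?F" using cont by (simp add: \<mu>_def)
  have F_mono: "mono ?F" using \<mu>.cdf_nondecreasing by (simp add: mono_def)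
  then have [measurable]: "?F \<in> borel_measurable borel" by (rule borel_measurable_mono)
  have F_int: "integrable \<mu> ?F" "integrable \<mu> (\<lambda>y. (?F y)\<^sup>2)"
    using \<mu>.integrable_cdf_power[of 1] by simp_all
  note F_moments = \<mu>.cdf_moments[OF cont]
  let ?H = "\<lambda>y. \<P>(\<omega> in N. Y (\<pi> \<omega>) \<ge> y \<and> Y' \<omega> \<ge> y)"
  let ?D = "\<lambda>\<omega>. \<bar>?F (Y (\<pi> \<omega>)) - ?F (Y' \<omega>)\<bar>"

  have laws: "distr N borel (\<lambda>\<omega>. Y (\<pi> \<omega>)) = \<mu>" "distr N borel Y' = \<mu>"
  proof -
    have "distr N borel (Y \<circ> \<pi>) = \<mu>"
      using distr_distr[OF Y \<pi>] by (simp add: M_eq \<mu>_def)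
    then show "distr N borel (\<lambda>\<omega>. Y (\<pi> \<omega>)) = \<mu>" "distr N borel Y' = \<mu>"
      using N.markov_product_same_law[OF assms(6)] by (simp_all add: comp_def)
  qed
  have means: "(LINT \<omega>|N. ?F (Y (\<pi> \<omega>))) = 1 / 2" "(LINT \<omega>|N. ?F (Y' \<omega>)) = 1 / 2"
    using integral_distr[of "\<lambda>\<omega>. Y (\<pi> \<omega>)" N borel ?F] integral_distr[of Y' N borel ?F]
    by (simp_all add: laws F_moments)
  have F_bounds: "0 \<le> ?F y" "?F y \<le> 1" for y
    using \<mu>.cdf_nonneg \<mu>.cdf_bounded_prob by auto
  have ints: "integrable N (\<lambda>\<omega>. ?F (Y (\<pi> \<omega>)))" "integrable N (\<lambda>\<omega>. ?F (Y' \<omega>))"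
    by (rule N.integrable_const_bound[where B = 1]; simp add: F_bounds)+

  \<comment> \<open>The second identity: both sides equal \<open>1 - 3 * N.expectation ?D\<close>.\<close>
  have F_min: "?F (min a b) = (?F a + ?F b - \<bar>?F a - ?F b\<bar>) / 2" for a b
    using monoD[OF F_mono, of a b] monoD[OF F_mono, of b a] by (cases "a \<le> b") (simp_all add: min_def)
  have "(LINT y|\<mu>. ?H y) = (LINT y|\<mu>. \<P>(\<omega> in N. y \<le> min (Y (\<pi> \<omega>)) (Y' \<omega>)))"
    by (simp add: min.bounded_iff)
  also have "\<dots> = (LINT \<omega>|N. ?F (min (Y (\<pi> \<omega>)) (Y' \<omega>)))"
    by (rule \<mu>.integral_prob_ge) (unfold_locales, measurable)
  also have "\<dots> = (LINT \<omega>|N. (?F (Y (\<pi> \<omega>)) + ?F (Y' \<omega>) - ?D \<omega>) / 2)"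
    by (simp only: F_min)
  also have "\<dots> = (1 - N.expectation ?D) / 2"
    using ints by (simp add: means)
  finally have H_D: "(LINT y|\<mu>. ?H y) = (1 - N.expectation ?D) / 2" .

  have D_le: "\<bar>?F a - ?F b\<bar> \<le> 1" for a b
    using F_bounds[of a] F_bounds[of b] by linarith
  have "(LBINT s:{0..1}. \<P>(\<omega> in N. ?D \<omega> \<le> s)) = 1 - N.expectation ?D"
    by (rule N.integral_distribution_function) (simp_all add: D_le)
  with H_D have second: "6 * (LINT y|\<mu>. ?H y) - 2 = 3 * (LBINT s:{0..1}. \<P>(\<omega> in N. ?D \<omega> \<le> s)) - 2"
    by simp

  \<comment> \<open>The first identity: numerator and denominator of the rank correlation are integrated
    separately. \<open>?H\<close> is measurable because it is antitone.\<close>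
  have H_int: "integrable \<mu> ?H"
  proof (rule \<mu>.integrable_const_bound[where B = 1])
    have "mono (\<lambda>y. - ?H y)"
      by (intro monoI le_imp_neg_le N.finite_measure_mono) auto
    then show "?H \<in> borel_measurable \<mu>"
      by (rule borel_measurable_uminus_eq[THEN iffD1, OF \<mu>.measurable_finite_borel[OF borel_measurable_mono]])
  qed simp
  have tail: "\<P>(\<omega> in M. Y \<omega> \<ge> y) = 1 - ?F y" for y
  proof -
    have "\<P>(\<omega> in M. Y \<omega> \<ge> y) = measure \<mu> {y..}"
      unfolding \<mu>_def by (subst measure_distr) (auto intro!: arg_cong[where f = M.prob])
    then show ?thesis using \<mu>.prob_atLeast_eq[OF cont] by simp
  qed
  have num: "M.variance (cond_prob_given M X {\<omega> \<in> space M. Y \<omega> \<ge> y}) = ?H y - (1 - ?F y)\<^sup>2" for y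
    using variance_cond_prob_given_eq[OF assms(1,2,3,5,6), of "{y..}"] by (simp add: tail)
  have den: "M.variance (indicator {\<omega> \<in> space M. Y \<omega> \<ge> y}) = ?F y - (?F y)\<^sup>2" for y
  proof -
    let ?I = "indicator {\<omega> \<in> space M. Y \<omega> \<ge> y} :: 'a \<Rightarrow> real"
    have "(\<lambda>\<omega>. (?I \<omega>)\<^sup>2) = ?I" by (auto simp: indicator_def)
    moreover have "integrable M ?I" by (simp add: M.emeasure_eq_measure)
    ultimately have "M.variance ?I = \<P>(\<omega> in M. Y \<omega> \<ge> y) - (\<P>(\<omega> in M. Y \<omega> \<ge> y))\<^sup>2"
      using M.variance_eq[of ?I] by simp
    also have "\<dots> = ?F y - (?F y)\<^sup>2"
      unfolding tail by (simp add: power2_diff)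
    finally show ?thesis .
  qed
  have "(LINT y|\<mu>. h y - (1 - ?F y)\<^sup>2) = (LINT y|\<mu>. h y) - 1 / 3" if "integrable \<mu> h" for h
  proof -
    have "(1 - ?F y)\<^sup>2 = 1 + (?F y)\<^sup>2 - 2 * ?F y" for y
      by (simp add: power2_diff)
    then show ?thesis
      using that F_int F_moments \<mu>.prob_space by simp
  qed
  from this[OF H_int] have num_int: "(LINT y|\<mu>. ?H y - (1 - ?F y)\<^sup>2) = (LINT y|\<mu>. ?H y) - 1 / 3" .
  have den_int: "(LINT y|\<mu>. ?F y - (?F y)\<^sup>2) = 1 / 6"
    using Bochner_Integration.integral_diff[OF F_int] F_moments by simp
  have "chatterjee_xi M Y X = 6 * (LINT y|\<mu>. ?H y) - 2"
    unfolding chatterjee_xi_def \<mu>_def[symmetric] num den num_int den_int by simp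
  with second show ?thesis
    unfolding \<mu>_def[symmetric] by (rule conjI[rotated])
qed

end
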